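(* Let $S=\langle n_0,\ldots,n_p\rangle$ be a numerical semigroup on a compound sequence (NSCS), with associated integers $a_1,\ldots,a_p,b_1,\ldots,b_p$, and let $i\in[0,p]$. Then the Apéry set $Ap(S,n_i)$ equals $\{\phi(u):u\in S_i\}$, where \[S_i=\left\{u\in\mathbb{N}_0^{p+1}: u_j<b_{j+1}\text{ for all }0\le j<i,\ \ u_i=0,\ \ u_j<a_j\text{ for all }i<j\le p\right\}.\]
   Context: Let $\mathbb{N}$ be the positive integers and $\mathbb{N}_0$ the nonnegative integers. A compound sequence is a sequence $\{n_0,\ldots,n_p\}$ with $n_i=b_1b_2\cdots b_i\,a_{i+1}a_{i+2}\cdots a_p$ for $i\in[0,p]$, where $p,a_1,\ldots,a_p,b_1,\ldots,b_p\in\mathbb{N}$ satisfy $2\le a_i<b_i$ for all $i\in[1,p]$ and $\gcd(a_i,b_j)=1$ for all $i,j\in[1,p]$ with $i\ge j$. An NSCS is a numerical semigroup $S=\langle n_0,\ldots,n_p\rangle$ whose minimal generators form a compound sequence. The factorization homomorphism is $\phi:\mathbb{N}_0^{p+1}\to S$, $\phi(x_0,\ldots,x_p)=x_0n_0+\cdots+x_pn_p$. For $m\in S$, the Apéry set is $Ap(S,m)=\{n\in S:n-m\notin S\}$. *)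

theory Defs
  imports Complex_Main "HOL-Library.FuncSet"
begin

definition submonoid_nat :: "nat set \<Rightarrow> bool" where
  "submonoid_nat S \<longleftrightarrow> 0 \<in> S \<and> (\<forall>x\<in>S. \<forall>y\<in>S. x + y \<in> S)"

definition numerical_semigroup :: "nat set \<Rightarrow> bool" where
  "numerical_semigroup S \<longleftrightarrow> submonoid_nat S \<and> finite (- S)"

definition generated :: "nat set \<Rightarrow> nat set" where
  "generated A = submonoid_nat hull A"

definition minimal_generators :: "nat set \<Rightarrow> nat set \<Rightarrow> bool" where
  "minimal_generators A S \<longleftrightarrow> generated A = S \<and> (\<forall>B. B \<subset> A \<longrightarrow> generated B \<noteq> S)"

(* The families a and b are only relevant on the indices 1..p. *)
definition compound_params :: "nat \<Rightarrow> (nat \<Rightarrow> nat) \<Rightarrow> (nat \<Rightarrow> nat) \<Rightarrow> bool" where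
  "compound_params p a b \<longleftrightarrow>
     1 \<le> p \<and>
     (\<forall>i\<in>{1..p}. 2 \<le> a i \<and> a i < b i) \<and>
     (\<forall>i\<in>{1..p}. \<forall>j\<in>{1..p}. j \<le> i \<longrightarrow> gcd (a i) (b j) = 1)"

definition compound_seq :: "nat \<Rightarrow> (nat \<Rightarrow> nat) \<Rightarrow> (nat \<Rightarrow> nat) \<Rightarrow> nat \<Rightarrow> nat" where
  "compound_seq p a b i = (\<Prod>j=1..i. b j) * (\<Prod>j=i+1..p. a j)"

definition NSCS :: "nat \<Rightarrow> (nat \<Rightarrow> nat) \<Rightarrow> (nat \<Rightarrow> nat) \<Rightarrow> nat set \<Rightarrow> bool" where
  "NSCS p a b S \<longleftrightarrow>
     compound_params p a b \<and> numerical_semigroup S \<and>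
     minimal_generators (compound_seq p a b ` {0..p}) S"

(* The tuples of length p + 1 are the extensional functions on {0..p}. *)
definition tuples :: "nat \<Rightarrow> (nat \<Rightarrow> nat) set" where
  "tuples p = {0..p} \<rightarrow>\<^sub>E UNIV"

definition factorization_hom :: "nat \<Rightarrow> (nat \<Rightarrow> nat) \<Rightarrow> (nat \<Rightarrow> nat) \<Rightarrow> nat" where
  "factorization_hom p n x = (\<Sum>j=0..p. x j * n j)"

(* The difference is taken in the integers: truncated subtraction would
   wrongly exclude the elements of S below m. *)
definition Apery :: "nat set \<Rightarrow> nat \<Rightarrow> nat set" where
  "Apery S m = {n \<in> S. int n - int m \<notin> int ` S}"

end

theory Submission
  imports Defs
begin

text \<open>
  Write \<open>n\<^sub>j\<close> for the generators. Since \<open>b\<^sub>j n\<^sub>j\<^sub>-\<^sub>1 = a\<^sub>j n\<^sub>j\<close>, any factorization can be pushed from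
  both ends towards position \<open>i\<close>, so that every element of \<open>S\<close> has the form \<open>\<phi>(u) + k n\<^sub>i\<close> with
  \<open>u \<in> S\<^sub>i\<close>. As \<open>S\<close> is cofinite it meets every residue class modulo \<open>n\<^sub>i\<close>; since \<open>S\<^sub>i\<close> has exactly
  \<open>n\<^sub>i\<close> elements, \<open>\<phi>\<close> is injective modulo \<open>n\<^sub>i\<close> on \<open>S\<^sub>i\<close>. Both inclusions follow.
\<close>

text \<open>The set S_i in the exact wording of the theorem, so that the final step only unfolds
  this name. Membership in \<open>tuples p\<close> fixes the values outside {0..p}, without which
  the set could not be finite.\<close>

definition reduced_box :: "nat \<Rightarrow> (nat \<Rightarrow> nat) \<Rightarrow> (nat \<Rightarrow> nat) \<Rightarrow> nat \<Rightarrow> (nat \<Rightarrow> nat) set" where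
  "reduced_box p a b i = {u \<in> tuples p. (\<forall>j. 0 \<le> j \<and> j < i \<longrightarrow> u j < b (j + 1)) \<and> u i = 0 \<and>
                     (\<forall>j. i < j \<and> j \<le> p \<longrightarrow> u j < a j)}"

section \<open>The exchange relation between neighbouring generators, and carrying along it\<close>

lemma compound_seq_relation:
  assumes "j < p"
  shows "b (Suc j) * compound_seq p a b j = a (Suc j) * compound_seq p a b (Suc j)"
proof -
  \<comment> \<open>With this factor split off, both sides are the product of b_1, ..., b_{j+1} and
    a_{j+1}, ..., a_p.\<close>
  have "(\<Prod>k=j+1..p. a k) = a (Suc j) * (\<Prod>k=Suc j+1..p. a k)"
    using assms by (simp add: prod.atLeast_Suc_atMost)
  then show ?thesis
    by (simp add: compound_seq_def)
qed

lemma compound_params_pos: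
  assumes "compound_params p a b" "j \<in> {1..p}"
  shows "a j > 0" "b j > 0"
proof -
  have "2 \<le> a j \<and> a j < b j"
    using assms by (simp add: compound_params_def)
  then show "a j > 0" "b j > 0" by auto
qed

lemma compound_seq_pos:
  assumes "compound_params p a b" "i \<le> p"
  shows "compound_seq p a b i > 0"
  using assms(2) compound_params_pos[OF assms(1)]
  by (auto simp: compound_seq_def intro!: prod_pos)

text \<open>Works like carrying in a mixed radix system: b_{j+1} copies of n_j are traded for
  a_{j+1} copies of n_{j+1}, from position 0 upwards. The remainder stays at j, and the unbounded
  excess collects in \<open>k\<close> at position i.\<close>

lemma carry_upwards:
  fixes n a b x :: "nat \<Rightarrow> nat"
  assumes "\<And>j. j < i \<Longrightarrow> b (Suc j) * n j = a (Suc j) * n (Suc j)"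
    and "\<And>j. j < i \<Longrightarrow> b (Suc j) > 0"
  shows "\<exists>u k. (\<forall>j<i. u j < b (Suc j)) \<and> (\<Sum>j\<le>i. x j * n j) = (\<Sum>j<i. u j * n j) + k * n i"
  using assms
proof (induction i)
  case 0
  then show ?case by auto
next
  case (Suc i)
  then obtain u k where u: "\<forall>j<i. u j < b (Suc j)"
    and eq: "(\<Sum>j\<le>i. x j * n j) = (\<Sum>j<i. u j * n j) + k * n i"
    by fastforce
  \<comment> \<open>\<open>k\<close> is everything collected at i so far. The remainder
    \<open>r\<close> becomes the final entry there, and the quotient \<open>q\<close> counts the
    exchanges into position i + 1.\<close>
  define r q where "r = k mod b (Suc i)" and "q = k div b (Suc i)"
  have "k * n i = r * n i + q * (b (Suc i) * n i)"
    unfolding r_def q_def by (metis add_mult_distrib mod_div_mult_eq mult.assoc)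
  also have "\<dots> = r * n i + q * a (Suc i) * n (Suc i)"
    using Suc.prems(1)[of i] by simp
  finally have "(\<Sum>j\<le>Suc i. x j * n j)
      = (\<Sum>j<Suc i. (u(i := r)) j * n j) + (q * a (Suc i) + x (Suc i)) * n (Suc i)"
    using eq by (simp add: add_mult_distrib)
  moreover have "\<forall>j<Suc i. (u(i := r)) j < b (Suc j)"
    using u Suc.prems(2)[of i] by (simp add: r_def less_Suc_eq)
  ultimately show ?case by blast
qed

text \<open>The mirror image: a_{j+1} copies of n_{j+1} are traded for b_{j+1} copies of n_j.
  Carries now move towards smaller indices, so the induction starts at p and descends to i.\<close>

lemma carry_downwards:
  fixes n a b x :: "nat \<Rightarrow> nat"
  assumes "i \<le> p"
    and "\<And>j. j < p \<Longrightarrow> b (Suc j) * n j = a (Suc j) * n (Suc j)"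
    and "\<And>j. j < p \<Longrightarrow> a (Suc j) > 0"
  shows "\<exists>u k. (\<forall>j\<in>{Suc i..p}. u j < a j) \<and>
    (\<Sum>j=i..p. x j * n j) = k * n i + (\<Sum>j=Suc i..p. u j * n j)"
  using assms(1)
proof (induction i rule: inc_induct)
  case base
  then show ?case by auto
next
  case (step i)
  then obtain u k where u: "\<forall>j\<in>{Suc (Suc i)..p}. u j < a j"
    and eq: "(\<Sum>j=Suc i..p. x j * n j) = k * n (Suc i) + (\<Sum>j=Suc (Suc i)..p. u j * n j)"
    by blast
  define r q where "r = k mod a (Suc i)" and "q = k div a (Suc i)"
  let ?u = "u(Suc i := r)"
  have "k * n (Suc i) = r * n (Suc i) + q * (a (Suc i) * n (Suc i))"
    unfolding r_def q_def by (metis add_mult_distrib mod_div_mult_eq mult.assoc)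
  also have "\<dots> = r * n (Suc i) + q * b (Suc i) * n i"
    using assms(2)[of i] step.hyps by simp
  finally have carry: "k * n (Suc i) = r * n (Suc i) + q * b (Suc i) * n i" .
  have "(\<Sum>j=Suc i..p. ?u j * n j) = r * n (Suc i) + (\<Sum>j=Suc (Suc i)..p. u j * n j)"
    using step.hyps by (simp add: sum.atLeast_Suc_atMost)
  moreover have "(\<Sum>j=i..p. x j * n j) = x i * n i + (\<Sum>j=Suc i..p. x j * n j)"
    using step.hyps by (simp add: sum.atLeast_Suc_atMost)
  ultimately have "(\<Sum>j=i..p. x j * n j)
      = (x i + q * b (Suc i)) * n i + (\<Sum>j=Suc i..p. ?u j * n j)"
    using eq carry by (simp add: add_mult_distrib)
  moreover have "\<forall>j\<in>{Suc i..p}. ?u j < a j"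
    using u assms(3)[of i] step.hyps by (auto simp: r_def)
  ultimately show ?case by blast
qed

section \<open>Reduced factorizations and their number\<close>

lemma sum_split_at:
  fixes f :: "nat \<Rightarrow> nat"
  assumes "i \<le> p"
  shows "(\<Sum>j=0..p. f j) = (\<Sum>j<i. f j) + (f i + (\<Sum>j=Suc i..p. f j))"
proof -
  have "(\<Sum>j=0..p. f j) = sum f ({..<i} \<union> {i..p})"
    using assms by (intro sum.cong) auto
  also have "\<dots> = (\<Sum>j<i. f j) + (\<Sum>j=i..p. f j)"
    by (intro sum.union_disjoint) auto
  finally show ?thesis
    using assms by (simp add: sum.atLeast_Suc_atMost)
qed

text \<open>The two carries act on disjoint sides of i and deliver their excess to the same place,
  so the multiples of n_i simply add up.\<close>

lemma reduced_factorization_exists: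
  assumes params: "compound_params p a b" and i: "i \<le> p"
  shows "\<exists>u\<in>reduced_box p a b i. \<exists>k. factorization_hom p (compound_seq p a b) x
    = factorization_hom p (compound_seq p a b) u + k * compound_seq p a b i"
proof -
  let ?n = "compound_seq p a b"
  have pos: "a (Suc j) > 0" "b (Suc j) > 0" if "j < p" for j
    using compound_params_pos[OF params, of "Suc j"] that by auto
  obtain v k where v: "\<forall>j<i. v j < b (Suc j)"
    and veq: "(\<Sum>j\<le>i. x j * ?n j) = (\<Sum>j<i. v j * ?n j) + k * ?n i"
    using carry_upwards[of i b ?n a x, OF compound_seq_relation pos(2)] i by force
  \<comment> \<open>The entry at i is zeroed because the upward carry has already counted
    \<open>x i\<close>.\<close>
  obtain w l where w: "\<forall>j\<in>{Suc i..p}. w j < a j"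
    and weq: "(\<Sum>j=i..p. (x(i := 0)) j * ?n j) = l * ?n i + (\<Sum>j=Suc i..p. w j * ?n j)"
    using carry_downwards[OF i, of b ?n a "x(i := 0)", OF compound_seq_relation pos(1)] by blast
  \<comment> \<open>All copies of n_i go into \<open>k + l\<close>, hence the entry 0 at i; the
    restriction makes \<open>u\<close> a member of \<open>tuples p\<close>.\<close>
  define u where "u = restrict (\<lambda>j. if j < i then v j else if j = i then 0 else w j) {0..p}"
  have "u \<in> reduced_box p a b i"
    using v w i by (auto simp: reduced_box_def tuples_def u_def)
  moreover have "factorization_hom p ?n x = factorization_hom p ?n u + (k + l) * ?n i"
  proof -
    have "factorization_hom p ?n x
        = (\<Sum>j\<le>i. x j * ?n j) + (\<Sum>j=i..p. (x(i := 0)) j * ?n j)"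
      unfolding factorization_hom_def sum_split_at[OF i] lessThan_Suc_atMost[symmetric]
      using i by (simp add: sum.atLeast_Suc_atMost)
    moreover have "factorization_hom p ?n u
        = (\<Sum>j<i. v j * ?n j) + (\<Sum>j=Suc i..p. w j * ?n j)"
      unfolding factorization_hom_def sum_split_at[OF i] using i by (simp add: u_def)
    ultimately show ?thesis
      using veq weq by (simp add: add_mult_distrib)
  qed
  ultimately show ?thesis by blast
qed

text \<open>Reading \<open>u i = 0\<close> as \<open>u i < 1\<close> makes all the conditions upper
  bounds on single coordinates. The set is then a finite product, and its size can be read
  off.\<close>

lemma reduced_box_eq_PiE:
  assumes "i \<le> p"
  shows "reduced_box p a b i =
    (\<Pi>\<^sub>E j\<in>{0..p}. {..<if j < i then b (Suc j) else if j = i then 1 else a j})"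
proof (rule set_eqI)
  fix u
  have "u \<in> reduced_box p a b i \<longleftrightarrow> u \<in> extensional {0..p} \<and>
      (u i = 0 \<and> (\<forall>j<i. u j < b (Suc j)) \<and> (\<forall>j. i < j \<and> j \<le> p \<longrightarrow> u j < a j))"
    by (auto simp: reduced_box_def tuples_def PiE_iff)
  moreover have "(u i = 0 \<and> (\<forall>j<i. u j < b (Suc j)) \<and> (\<forall>j. i < j \<and> j \<le> p \<longrightarrow> u j < a j)) \<longleftrightarrow>
      (\<forall>j\<in>{0..p}. u j < (if j < i then b (Suc j) else if j = i then 1 else a j))" (is "?L \<longleftrightarrow> ?R")
  proof
    assume ?L
    then show ?R by (simp add: not_less le_less)
  next
    assume R: ?R
    have "u j < b (Suc j)" if "j < i" for j
      using R[rule_format, of j] that assms by simp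
    moreover have "u j < a j" if "i < j" "j \<le> p" for j
      using R[rule_format, of j] that by simp
    ultimately show ?L
      using R[rule_format, of i] assms by simp
  qed
  ultimately show "u \<in> reduced_box p a b i \<longleftrightarrow>
      u \<in> (\<Pi>\<^sub>E j\<in>{0..p}. {..<if j < i then b (Suc j) else if j = i then 1 else a j})"
    by (simp only: PiE_iff lessThan_iff conj_commute)
qed

lemma finite_reduced_box:
  assumes "i \<le> p"
  shows "finite (reduced_box p a b i)"
  by (simp add: reduced_box_eq_PiE[OF assms] finite_PiE)

lemma card_reduced_box:
  assumes "i \<le> p"
  shows "card (reduced_box p a b i) = compound_seq p a b i"
proof -
  let ?f = "\<lambda>j. if j < i then b (Suc j) else if j = i then 1 else a j"
  have "card (reduced_box p a b i) = prod ?f {0..p}"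
    by (simp add: reduced_box_eq_PiE[OF assms] card_PiE)
  \<comment> \<open>The index shift matters here: positions 0, ..., i - 1 contribute b_1, ..., b_i,
    position i contributes 1, and the rest a_{i+1}, ..., a_p. This is n_i itself.\<close>
  also have "\<dots> = prod ?f ({..<i} \<union> ({i} \<union> {i+1..p}))"
    using assms by (intro prod.cong) auto
  also have "\<dots> = (\<Prod>j<i. b (Suc j)) * (\<Prod>j=i+1..p. a j)"
    by (subst prod.union_disjoint) auto
  also have "(\<Prod>j<i. b (Suc j)) = (\<Prod>j=1..i. b j)"
    by (simp add: prod.atLeast1_atMost_eq)
  finally show ?thesis
    by (simp add: compound_seq_def)
qed

section \<open>The semigroup as the image of the factorization homomorphism\<close>

lemma submonoid_nat_mult:
  assumes "submonoid_nat T" "m \<in> T"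
  shows "c * m \<in> T"
  using assms by (induction c) (auto simp: submonoid_nat_def)

text \<open>The image is a submonoid containing the generators, and every such submonoid contains
  each combination of them. Coefficients may be arbitrary functions, since entries beyond p do not
  enter the sum.\<close>

lemma generated_image_eq_range_factorization_hom:
  "generated (n ` {0..p}) = range (factorization_hom p n)"
proof
  have "submonoid_nat (range (factorization_hom p n))"
  proof -
    have "factorization_hom p n (\<lambda>_. 0) = 0"
      by (simp add: factorization_hom_def)
    moreover have "factorization_hom p n x + factorization_hom p n y
        = factorization_hom p n (\<lambda>j. x j + y j)" for x y
      by (simp add: factorization_hom_def sum.distrib add_mult_distrib)
    ultimately show ?thesis
      unfolding submonoid_nat_def by (auto intro: range_eqI[OF sym])
  qed
  moreover have "n ` {0..p} \<subseteq> range (factorization_hom p n)"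
  proof
    fix m assume "m \<in> n ` {0..p}"
    then obtain j where j: "j \<in> {0..p}" "m = n j" by blast
    then have "m = factorization_hom p n (\<lambda>k. if k = j then 1 else 0)"
      by (simp add: factorization_hom_def if_distrib[of "\<lambda>c. c * _"] cong: if_cong)
    then show "m \<in> range (factorization_hom p n)" by blast
  qed
  ultimately show "generated (n ` {0..p}) \<subseteq> range (factorization_hom p n)"
    unfolding generated_def by (simp add: hull_minimal)
next
  have "factorization_hom p n x \<in> T"
    if sub: "n ` {0..p} \<subseteq> T" and T: "submonoid_nat T" for x T
  proof -
    \<comment> \<open>Generalized from {0..p} to its subsets so that induction on the index set
      applies.\<close>
    have "(\<Sum>j\<in>A. x j * n j) \<in> T" if "finite A" "A \<subseteq> {0..p}" for A
      using that
    proof (induction A rule: finite_induct)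
      case empty
      then show ?case using T by (simp add: submonoid_nat_def)
    next
      case (insert j A)
      then have "n j \<in> T" using sub by blast
      then have "x j * n j \<in> T" by (rule submonoid_nat_mult[OF T])
      then show ?case using insert T by (simp add: submonoid_nat_def)
    qed
    then show ?thesis by (simp add: factorization_hom_def)
  qed
  then show "range (factorization_hom p n) \<subseteq> generated (n ` {0..p})"
    by (auto simp: generated_def hull_def)
qed

section \<open>Residues modulo a generator, and the Apery set\<close>

lemma cofinite_meets_residue_class:
  fixes S :: "nat set"
  assumes "finite (- S)" and "r < m"
  shows "\<exists>s\<in>S. s mod m = r"
proof -
  obtain N where N: "\<forall>x\<in>-S. x < N"
    using assms(1) by (meson finite_nat_set_iff_bounded)
  \<comment> \<open>Since \<open>r < m\<close> forces m to be at least 1, adding N copies of m moves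
    r past all gaps of S without changing its residue.\<close>
  have "N \<le> r + N * m"
    using assms(2) by (cases m) auto
  then have "r + N * m \<in> S"
    using N by (meson ComplI leD)
  then show ?thesis
    using assms(2) by (intro bexI[of _ "r + N * m"]) simp_all
qed

text \<open>Injectivity comes from counting instead of comparing coordinates: the map is onto the
  n_i residues, and its finite domain has n_i elements.\<close>

lemma factorization_hom_inj_mod:
  assumes "NSCS p a b S" and i: "i \<le> p"
  shows "inj_on (\<lambda>u. factorization_hom p (compound_seq p a b) u mod compound_seq p a b i)
    (reduced_box p a b i)"
proof (rule eq_card_imp_inj_on)
  let ?n = "compound_seq p a b"
  let ?f = "\<lambda>u. factorization_hom p ?n u mod ?n i"
  show "finite (reduced_box p a b i)"
    by (rule finite_reduced_box[OF i])
  have params: "compound_params p a b" and cofin: "finite (- S)"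
    and S: "S = range (factorization_hom p ?n)"
    using assms(1) unfolding NSCS_def numerical_semigroup_def minimal_generators_def
    by (auto simp: generated_image_eq_range_factorization_hom)
  have "?f ` reduced_box p a b i = {..<?n i}"
  proof
    show "?f ` reduced_box p a b i \<subseteq> {..<?n i}"
      using compound_seq_pos[OF params i] by auto
    \<comment> \<open>Some element of S has residue r, and passing to its reduced factorization
      changes it only by a multiple of n_i.\<close>
    show "{..<?n i} \<subseteq> ?f ` reduced_box p a b i"
    proof
      fix r assume "r \<in> {..<?n i}"
      then obtain x where x: "factorization_hom p ?n x mod ?n i = r"
        using cofinite_meets_residue_class[OF cofin, of r "?n i"] S by auto
      obtain u k where "u \<in> reduced_box p a b i"
        and "factorization_hom p ?n x = factorization_hom p ?n u + k * ?n i"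
        using reduced_factorization_exists[OF params i] by blast
      with x show "r \<in> ?f ` reduced_box p a b i"
        by (intro image_eqI[of _ _ u]) auto
    qed
  qed
  then show "card (?f ` reduced_box p a b i) = card (reduced_box p a b i)"
    by (simp add: card_reduced_box[OF i])
qed

theorem theorem15:
  fixes p i :: nat and a b :: "nat \<Rightarrow> nat" and S :: "nat set"
  assumes "NSCS p a b S"
    and "i \<in> {0..p}"
  shows "Apery S (compound_seq p a b i) =
    factorization_hom p (compound_seq p a b) `
      {u \<in> tuples p. (\<forall>j. 0 \<le> j \<and> j < i \<longrightarrow> u j < b (j + 1)) \<and> u i = 0 \<and>
                     (\<forall>j. i < j \<and> j \<le> p \<longrightarrow> u j < a j)}"
proof -
  let ?n = "compound_seq p a b"
  let ?\<phi> = "factorization_hom p ?n"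
  have i: "i \<le> p" using assms(2) by simp
  have params: "compound_params p a b" and monoid: "submonoid_nat S"
    and gen: "generated (?n ` {0..p}) = S"
    using assms(1) unfolding NSCS_def numerical_semigroup_def minimal_generators_def by auto
  have S: "S = range ?\<phi>"
    using gen by (simp add: generated_image_eq_range_factorization_hom)
  have ni: "?n i \<in> S"
    using gen assms(2) unfolding generated_def by (metis hull_inc imageI)
  have "Apery S (?n i) = ?\<phi> ` reduced_box p a b i"
  proof
    show "Apery S (?n i) \<subseteq> ?\<phi> ` reduced_box p a b i"
    proof
      fix m assume m: "m \<in> Apery S (?n i)"
      then obtain x where "m = ?\<phi> x"
        using S by (auto simp: Apery_def)
      then obtain u k where u: "u \<in> reduced_box p a b i" and eq: "m = ?\<phi> u + k * ?n i"
        using reduced_factorization_exists[OF params i] by blast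
      \<comment> \<open>Otherwise removing one copy of n_i would leave an element of S, which
        membership of m in the Apery set forbids.\<close>
      have "k = 0"
      proof (cases k)
        case (Suc l)
        then have "int m - int (?n i) = int (?\<phi> u + l * ?n i)"
          using eq by simp
        moreover have "?\<phi> u + l * ?n i \<in> S"
          using monoid submonoid_nat_mult[OF monoid ni, of l] rangeI[of ?\<phi> u] unfolding submonoid_nat_def S[symmetric]
          by blast
        ultimately have "int m - int (?n i) \<in> int ` S"
          by (simp only: imageI)
        then show ?thesis
          using m by (simp add: Apery_def)
      qed
      then show "m \<in> ?\<phi> ` reduced_box p a b i"
        using u eq by simp
    qed
    show "?\<phi> ` reduced_box p a b i \<subseteq> Apery S (?n i)"
    proof (rule image_subsetI)
      fix u assume u: "u \<in> reduced_box p a b i"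
      \<comment> \<open>If the difference lay in S, reducing it to some \<open>v\<close> in the box
        would give \<open>?\<phi> u = ?\<phi> v + (k + 1) * ?n i\<close>. Injectivity modulo n_i
        then yields \<open>u = v\<close>, although n_i is positive.\<close>
      have "int (?\<phi> u) - int (?n i) \<notin> int ` S"
      proof
        assume "int (?\<phi> u) - int (?n i) \<in> int ` S"
        then obtain x where "int (?\<phi> u) - int (?n i) = int (?\<phi> x)"
          using S by auto
        then have x: "?\<phi> u = ?\<phi> x + ?n i"
          by linarith
        obtain v k where v: "v \<in> reduced_box p a b i" and eq: "?\<phi> x = ?\<phi> v + k * ?n i"
          using reduced_factorization_exists[OF params i] by blast
        have "?\<phi> u mod ?n i = ?\<phi> v mod ?n i"
          by (simp add: x eq)
        then have "u = v"
          using factorization_hom_inj_mod[OF assms(1) i] u v by (auto dest: inj_onD)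
        then show False
          using x eq compound_seq_pos[OF params i] by simp
      qed
      then show "?\<phi> u \<in> Apery S (?n i)"
        using S by (auto simp: Apery_def)
    qed
  qed
  then show ?thesis
    by (simp add: reduced_box_def)
qed

end
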